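(* Let $R$ be a rectangle in the plane that is tiled by $n$ squares. Then there exists a positive real number $\lambda$ such that, after scaling the whole configuration (the rectangle together with its tiling) by the factor $\lambda$, the longest side of the scaled rectangle has length at most $4^{n}$ and every square tile of the scaled tiling has integer side length.
   Context: A tiling of a region by tiles means a finite family of closed tiles with pairwise disjoint interiors whose union is the region. *)

theory Defs
  imports "HOL-Analysis.Analysis"
begin

text \<open>
  Rectangles and squares are closed, non-degenerate, and of arbitrary position and orientation
  in the plane: the corner \<open>p\<close> and the two perpendicular edge vectors \<open>u\<close>, \<open>v\<close> are unrestricted.
  In particular the squares of a tiling are not assumed to be parallel to the tiled rectangle.
\<close>

definition rectangle_with_sides :: "(real^2) set \<Rightarrow> real \<Rightarrow> real \<Rightarrow> bool" where
  "rectangle_with_sides R a b \<longleftrightarrow>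
     (\<exists>p u v. u \<noteq> 0 \<and> v \<noteq> 0 \<and> orthogonal u v \<and> norm u = a \<and> norm v = b \<and>
        R = {p + s *\<^sub>R u + t *\<^sub>R v | s t. s \<in> {0..1} \<and> t \<in> {0..1}})"

definition is_rectangle :: "(real^2) set \<Rightarrow> bool" where
  "is_rectangle R \<longleftrightarrow> (\<exists>a b. rectangle_with_sides R a b)"

definition square_with_side :: "(real^2) set \<Rightarrow> real \<Rightarrow> bool" where
  "square_with_side S a \<longleftrightarrow> rectangle_with_sides S a a"

definition is_square :: "(real^2) set \<Rightarrow> bool" where
  "is_square S \<longleftrightarrow> (\<exists>a. square_with_side S a)"

text \<open>
  A family of tiles is given as a set of tiles. For tiles with non-empty interior, such as squares,
  disjointness of the interiors excludes repetitions, so the number of tiles is the cardinality.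
\<close>

definition is_tiling :: "(real^2) set set \<Rightarrow> (real^2) set \<Rightarrow> bool" where
  "is_tiling T R \<longleftrightarrow> finite T \<and> (\<forall>S\<in>T. closed S) \<and>
     pairwise (\<lambda>A B. interior A \<inter> interior B = {}) T \<and> \<Union>T = R"

definition dilate :: "real \<Rightarrow> (real^2) set \<Rightarrow> (real^2) set" where
  "dilate c A = (\<lambda>x. c *\<^sub>R x) ` A"

end

theory Submission
  imports Defs "Jordan_Normal_Form.Determinant"
begin

text \<open>
  Choose coordinates in which the rectangle is $[0,W] \times [0,H]$. No square is tilted: immediately
  to the right of the lowest corner \<open>p\<close> of all tilted squares lie only axis-parallel tiles, and such
  a tile contains a small box with lower left corner \<open>p\<close>, so it overlaps the tilted square standing
  on \<open>p\<close>.

  View the heights of the horizontal sides as the nodes of an electrical network in which a square is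
  a unit resistor between the heights of its lower and upper side. Voltage and current are both the
  side length. A horizontal line just above or just below a height crosses squares of total width \<open>W\<close>,
  which is Kirchhoff's current law. With node 0 grounded, the heights solve \<open>L h = W e\<close>, where \<open>L\<close> is
  the reduced Laplacian and \<open>e\<close> is the unit vector of the node \<open>H\<close>. After scaling by
  \<open>\<bar>det L\<bar> / W\<close>, Cramer's rule makes all heights integers, and the scaled width and height are the
  absolute values of determinants whose rows have absolute sum at most twice the degree \<open>d\<close> of the
  node. They are bounded by the product of all \<open>2 d \<le> 2 ^ d\<close>, and the degrees add up to at most \<open>2 n\<close>.
\<close>

hide_const (open) Matrix.orthogonal
hide_fact (open) Matrix.orthogonal_def

section \<open>Size and integrality of determinants\<close>

text \<open>Expanding the product of the row sums gives one term for every map of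
  \<open>{..<m}\<close> into itself, while the Leibniz formula uses only the permutations among
  them. Restriction to \<open>{..<m}\<close> is injective on permutations because they fix
  everything outside.\<close>

lemma abs_det_le_prod_row_sums:
  fixes A :: "real Matrix.mat"
  assumes A: "A \<in> carrier_mat m m"
  shows "\<bar>Determinant.det A\<bar> \<le> (\<Prod>i<m. \<Sum>j<m. \<bar>A $$ (i, j)\<bar>)"
proof -
  have "\<bar>Determinant.det A\<bar>
      \<le> (\<Sum>p | p permutes {0..<m}. \<bar>signof p * (\<Prod>i = 0..<m. A $$ (i, p i))\<bar>)"
    unfolding det_def'[OF A] by (rule sum_abs)
  also have "\<dots> = (\<Sum>p | p permutes {0..<m}. \<Prod>i<m. \<bar>A $$ (i, p i)\<bar>)"
    by (rule sum.cong) (auto simp: abs_mult abs_prod sign_def lessThan_atLeast0)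
  also have "\<dots> = (\<Sum>f\<in>(\<lambda>p. restrict p {..<m}) ` {p. p permutes {0..<m}}. \<Prod>i<m. \<bar>A $$ (i, f i)\<bar>)"
  proof (subst sum.reindex)
    show "inj_on (\<lambda>p. restrict p {..<m}) {p. p permutes {0..<m}}"
    proof (rule inj_onI, rule ext)
      fix p q x
      assume "p \<in> {p. p permutes {0..<m}}" "q \<in> {p. p permutes {0..<m}}"
        and eq: "restrict p {..<m} = restrict q {..<m}"
      then show "p x = q x"
        by (cases "x < m") (metis lessThan_iff restrict_apply, auto simp: permutes_not_in)
    qed
  qed (simp add: o_def)
  also have "\<dots> \<le> (\<Sum>f\<in>{..<m} \<rightarrow>\<^sub>E {..<m}. \<Prod>i<m. \<bar>A $$ (i, f i)\<bar>)"
  proof (rule sum_mono2)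
    show "(\<lambda>p. restrict p {..<m}) ` {p. p permutes {0..<m}} \<subseteq> {..<m} \<rightarrow>\<^sub>E {..<m}"
      by (auto dest: permutes_in_image)
  qed (auto intro!: finite_PiE prod_nonneg)
  also have "\<dots> = (\<Prod>i<m. \<Sum>j<m. \<bar>A $$ (i, j)\<bar>)"
    by (rule prod_sum_PiE[symmetric]) auto
  finally show ?thesis .
qed

lemma det_in_Ints:
  fixes A :: "real Matrix.mat"
  assumes A: "A \<in> carrier_mat m m" and "\<And>i j. i < m \<Longrightarrow> j < m \<Longrightarrow> A $$ (i, j) \<in> \<int>"
  shows "Determinant.det A \<in> \<int>"
  unfolding det_def'[OF A]
proof (intro Ints_sum Ints_mult Ints_prod)
  fix p i assume "p \<in> {p. p permutes {0..<m}}" "i \<in> {0..<m}"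
  then show "A $$ (i, p i) \<in> \<int>"
    using assms(2) by (auto dest: permutes_in_image)
qed (simp add: sign_def)

lemma two_mult_le_two_power: "2 * d \<le> (2::nat) ^ d"
proof (induction d)
  case (Suc d)
  show ?case
  proof (cases "d = 0")
    case False
    then have "(2::nat) ^ 1 \<le> 2 ^ d" by (intro power_increasing) auto
    then show ?thesis using Suc by simp
  qed simp
qed simp

section \<open>The electrical network and its Laplacian\<close>

text \<open>The combinatorial core: only the vertical extents of the squares are kept. Their
  horizontal arrangement enters through \<open>kirchhoff\<close> alone.\<close>

lemma network_integral_scaling:
  fixes bot top :: "'i \<Rightarrow> real"
  assumes fin: "finite I"
    and bot: "\<And>i. i \<in> I \<Longrightarrow> 0 \<le> bot i"
    and bt: "\<And>i. i \<in> I \<Longrightarrow> bot i < top i"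
    and "W > 0" and "H > 0"
    and H: "H \<in> top ` I"
    and kirchhoff: "\<And>t. 0 < t \<Longrightarrow> t \<in> top ` I \<union> bot ` I \<Longrightarrow>
      (\<Sum>i\<in>I. (of_bool (top i = t) - of_bool (bot i = t)) * (top i - bot i)) = (if t = H then W else 0)"
  shows "\<exists>c>0. c * W \<le> 4 ^ card I \<and> c * H \<le> 4 ^ card I \<and> (\<forall>i\<in>I. c * (top i - bot i) \<in> \<int>)"
proof -
  define Y where "Y = (top ` I \<union> bot ` I) - {0}"
  have "finite Y" using fin by (simp add: Y_def)
  define m where "m = card Y"
  obtain h where h: "bij_betw h {..<m} Y"
    using \<open>finite Y\<close> ex_bij_betw_nat_finite[of Y] by (auto simp: m_def lessThan_atLeast0)
  have hY: "h j \<in> Y" if "j < m" for j using h that by (auto simp: bij_betw_def)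
  have h_inj: "h j = h k \<longleftrightarrow> j = k" if "j < m" "k < m" for j k
    using h that by (auto simp: bij_betw_def inj_on_def)
  have h_surj: "\<exists>j<m. h j = t" if "t \<in> Y" for t
    using h that unfolding bij_betw_def by (metis imageE lessThan_iff)
  have h_pos: "h j > 0" if "j < m" for j
    using hY[OF that] bot bt by (force simp: Y_def)
  have "H \<in> Y" using H \<open>H > 0\<close> by (auto simp: Y_def)
  then obtain s where s: "s < m" "h s = H" using h_surj by blast
  \<comment> \<open>The incidence matrix of the network with the column of the grounded node 0
    deleted. A square standing on the ground therefore has a row with the single entry 1.\<close>
  define B :: "'i \<Rightarrow> nat \<Rightarrow> real"
    where "B = (\<lambda>i j. of_bool (top i = h j) - of_bool (bot i = h j))"
  have B_Ints: "B i j \<in> \<int>" for i j by (auto simp: B_def of_bool_def)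
  have B_abs: "\<bar>B i j\<bar> = of_bool (top i = h j) + of_bool (bot i = h j)" if "i \<in> I" for i j
    using bt[OF that] by (auto simp: B_def)
  \<comment> \<open>\<open>B\<close> takes potential differences along the squares. The condition
    \<open>f 0 = 0\<close> makes up for the deleted column.\<close>
  have B_ap: "(\<Sum>j<m. B i j * f (h j)) = f (top i) - f (bot i)" if i: "i \<in> I" and f0: "f 0 = 0" for i and f :: "real \<Rightarrow> real"
  proof -
    have one: "(\<Sum>j<m. of_bool (t = h j) * f (h j)) = f t" if tI: "t \<in> top ` I \<union> bot ` I" for t
    proof (cases "t = 0")
      case True
      have "of_bool (t = h j) * f (h j) = 0" if "j < m" for j using h_pos[OF that] True by auto
      then show ?thesis using True f0 by simp
    next
      case False
      then obtain k where k: "k < m" "h k = t" using h_surj[of t] tI by (auto simp: Y_def)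
      have "(\<Sum>j<m. of_bool (t = h j) * f (h j)) = (\<Sum>j<m. if j = k then f t else 0)"
        using k h_inj by (intro sum.cong) auto
      also have "\<dots> = f t" using k by simp
      finally show ?thesis .
    qed
    show ?thesis
      using one[of "top i"] one[of "bot i"] i by (simp add: B_def left_diff_distrib sum_subtractf)
  qed
  have B_row: "(\<Sum>j<m. \<bar>B i j\<bar>) \<le> 2" if i: "i \<in> I" for i
  proof -
    have one: "(\<Sum>j<m. of_bool (t = h j)) \<le> (1::real)" for t
    proof (cases "\<exists>k<m. t = h k")
      case True
      then obtain k where k: "k < m" "t = h k" by blast
      have "(\<Sum>j<m. of_bool (t = h j)) = (\<Sum>j<m. if j = k then 1 else (0::real))"
        using k h_inj by (intro sum.cong) auto
      then show ?thesis using k by simp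
    qed (auto simp: sum_nonneg)
    show ?thesis using one[of "top i"] one[of "bot i"] i by (simp add: B_abs sum.distrib)
  qed
  define d where "d j = card {i\<in>I. top i = h j} + card {i\<in>I. bot i = h j}" for j
  have d: "(\<Sum>i\<in>I. \<bar>B i j\<bar>) = real (d j)" for j
    using fin by (simp add: B_abs sum.distrib d_def of_bool_def sum.If_cases Int_def)
  define L where "L = Matrix.mat m m (\<lambda>(j, k). \<Sum>i\<in>I. B i j * B i k)"
  have L: "L \<in> carrier_mat m m" by (simp add: L_def)
  \<comment> \<open>Entrywise, |L| is at most |B|^T |B|. The rows of |B| sum to at most 2, and its
    column \<open>j\<close> sums to the degree \<open>d j\<close>.\<close>
  have L_row: "(\<Sum>k<m. \<bar>L $$ (j, k)\<bar>) \<le> 2 * real (d j)" if j: "j < m" for j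
  proof -
    have "(\<Sum>k<m. \<bar>L $$ (j, k)\<bar>) \<le> (\<Sum>k<m. \<Sum>i\<in>I. \<bar>B i j\<bar> * \<bar>B i k\<bar>)"
      using j by (intro sum_mono) (auto simp: L_def abs_mult[symmetric])
    also have "\<dots> = (\<Sum>i\<in>I. \<bar>B i j\<bar> * (\<Sum>k<m. \<bar>B i k\<bar>))"
      by (subst sum.swap) (simp add: sum_distrib_left)
    also have "\<dots> \<le> (\<Sum>i\<in>I. \<bar>B i j\<bar> * 2)"
      by (intro sum_mono mult_left_mono B_row) auto
    also have "\<dots> = 2 * real (d j)" by (simp add: d flip: sum_distrib_right)
    finally show ?thesis .
  qed
  have prod_d: "(\<Prod>j<m. 2 * real (d j)) \<le> 4 ^ card I"
  proof -
    have "(\<Prod>j<m. 2 * real (d j)) \<le> (\<Prod>j<m. 2 ^ d j)"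
    proof (intro prod_mono conjI)
      fix j
      have "real (2 * d j) \<le> real (2 ^ d j)" by (simp only: of_nat_le_iff two_mult_le_two_power)
      then show "2 * real (d j) \<le> 2 ^ d j" by simp
    qed simp
    also have "\<dots> = 2 ^ (\<Sum>j<m. d j)" by (simp add: power_sum)
    also have "\<dots> \<le> 2 ^ (2 * card I)"
    proof (rule power_increasing)
      \<comment> \<open>Handshake count: summing |B| by columns gives the degrees, summing it by
        rows gives at most 2 per square.\<close>
      have "real (\<Sum>j<m. d j) = (\<Sum>i\<in>I. \<Sum>j<m. \<bar>B i j\<bar>)"
        by (subst sum.swap) (simp add: d)
      also have "\<dots> \<le> (\<Sum>i\<in>I. 2)" by (intro sum_mono B_row)
      finally have "real (\<Sum>j<m. d j) \<le> real (2 * card I)" by simp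
      then show "(\<Sum>j<m. d j) \<le> 2 * card I" by (simp only: of_nat_le_iff)
    qed simp
    finally show ?thesis by (simp add: power_mult)
  qed
  have det_bound: "\<bar>Determinant.det M\<bar> \<le> 4 ^ card I"
    if M: "M \<in> carrier_mat m m" and le: "\<And>j k. j < m \<Longrightarrow> k < m \<Longrightarrow> \<bar>M $$ (j, k)\<bar> \<le> \<bar>L $$ (j, k)\<bar>" for M
  proof -
    have "\<bar>Determinant.det M\<bar> \<le> (\<Prod>j<m. \<Sum>k<m. \<bar>M $$ (j, k)\<bar>)"
      by (rule abs_det_le_prod_row_sums[OF M])
    also have "\<dots> \<le> (\<Prod>j<m. \<Sum>k<m. \<bar>L $$ (j, k)\<bar>)"
      using le by (intro prod_mono conjI sum_mono sum_nonneg) auto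
    also have "\<dots> \<le> (\<Prod>j<m. 2 * real (d j))"
      using L_row by (intro prod_mono conjI sum_nonneg) auto
    finally show ?thesis using prod_d by linarith
  qed
  have L_ap: "(\<Sum>k<m. L $$ (j, k) * w k) = (\<Sum>i\<in>I. B i j * (\<Sum>k<m. B i k * w k))" if "j < m" for j w
  proof -
    have "(\<Sum>k<m. L $$ (j, k) * w k) = (\<Sum>k<m. \<Sum>i\<in>I. B i j * (B i k * w k))"
      using that by (intro sum.cong) (auto simp: L_def sum_distrib_right mult.assoc)
    also have "\<dots> = (\<Sum>i\<in>I. B i j * (\<Sum>k<m. B i k * w k))"
      by (subst sum.swap) (simp add: sum_distrib_left)
    finally show ?thesis .
  qed
  have L_mult: "Matrix.vec_index (L *\<^sub>v Matrix.vec m w) j = (\<Sum>k<m. L $$ (j, k) * w k)" if "j < m" for j w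
    using that by (simp add: L_def scalar_prod_def lessThan_atLeast0)
  \<comment> \<open>If no square ended at \<open>t\<close>, only squares starting there would
    contribute, and the Kirchhoff sum would be negative instead of 0 or \<open>W\<close>. This
    replaces a connectivity argument: from every node one can descend along a square.\<close>
  have top_ex: "\<exists>i\<in>I. top i = t" if tY: "t \<in> Y" for t
  proof (rule ccontr)
    assume no: "\<not> ?thesis"
    then obtain i where i: "i \<in> I" "bot i = t" using tY by (auto simp: Y_def)
    have t: "0 < t" "t \<in> top ` I \<union> bot ` I" using tY bot bt by (force simp: Y_def)+
    have "0 < (\<Sum>i\<in>I. of_bool (bot i = t) * (top i - bot i))"
      by (rule sum_pos2[OF fin i(1)]) (use i bt in \<open>auto simp: less_imp_le\<close>)
    also have "\<dots> = - (\<Sum>i\<in>I. (of_bool (top i = t) - of_bool (bot i = t)) * (top i - bot i))"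
      using no by (auto simp flip: sum_negf intro!: sum.cong)
    finally have "(\<Sum>i\<in>I. (of_bool (top i = t) - of_bool (bot i = t)) * (top i - bot i)) < 0"
      by simp
    then show False using kirchhoff[OF t] \<open>W > 0\<close> by (auto split: if_splits)
  qed
  \<comment> \<open>A kernel vector has zero energy, hence equal potentials at both ends of every
    square. The lowest node with nonzero potential is the upper end of some square, whose lower end
    then has nonzero potential too. That end is not the ground, and it lies lower: a
    contradiction.\<close>
  have det_L: "Determinant.det L \<noteq> 0"
  proof
    assume "Determinant.det L = 0"
    then obtain v where v: "v \<in> carrier_vec m" "v \<noteq> 0\<^sub>v m" "L *\<^sub>v v = 0\<^sub>v m"
      using det_0_iff_vec_prod_zero[OF L] by blast
    define w where "w = Matrix.vec_index v"
    have vw: "v = Matrix.vec m w" using v(1) by (auto simp: w_def)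
    have Lw: "(\<Sum>k<m. L $$ (j, k) * w k) = 0" if "j < m" for j
      using L_mult[OF that, of w] v(3) that by (simp add: vw)
    \<comment> \<open>The energy \<open>w\<^sup>T L w\<close>, since \<open>L = B\<^sup>T B\<close>.\<close>
    have "(\<Sum>i\<in>I. (\<Sum>k<m. B i k * w k)\<^sup>2) = (\<Sum>j<m. w j * (\<Sum>k<m. L $$ (j, k) * w k))"
      by (simp add: L_ap sum_distrib_left power2_eq_square sum_distrib_right, subst sum.swap) (simp add: ac_simps)
    also have "\<dots> = 0" by (simp add: Lw)
    finally have Bw: "(\<Sum>k<m. B i k * w k) = 0" if "i \<in> I" for i
      using that fin by (simp add: sum_nonneg_eq_0_iff)
    \<comment> \<open>The kernel vector as a potential on heights, with default value 0 outside
      \<open>Y\<close>, in particular at the ground.\<close>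
    define f where "f t = (if t \<in> Y then w (inv_into {..<m} h t) else 0)" for t
    have f0: "f 0 = 0" by (simp add: f_def Y_def)
    have fh: "f (h j) = w j" if "j < m" for j
      using that h hY by (simp add: f_def bij_betw_def)
    have f_eq: "f (top i) = f (bot i)" if "i \<in> I" for i
      using B_ap[OF that, of f] f0 Bw[OF that] by (simp add: fh)
    have f_zero: "f t = 0" for t
    proof (rule ccontr)
      assume "f t \<noteq> 0"
      define Z where "Z = {t \<in> Y. f t \<noteq> 0}"
      have Z: "finite Z" "Z \<noteq> {}" using \<open>finite Y\<close> \<open>f t \<noteq> 0\<close> by (auto simp: Z_def f_def split: if_splits)
      then have MZ: "Min Z \<in> Z" by simp
      then obtain i where i: "i \<in> I" "top i = Min Z" using top_ex by (auto simp: Z_def)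
      then have "bot i \<in> Z" using f_eq[OF i(1)] MZ f0 by (auto simp: Z_def Y_def)
      then show False using Min_le[OF Z(1)] bt[OF i(1)] i(2) by fastforce
    qed
    have "w j = 0" if "j < m" for j using fh[OF that] f_zero by simp
    then show False using v(2) by (auto simp: vw)
  qed
  \<comment> \<open>\<open>B\<close> applied to the heights gives the side lengths, and the
    transpose of \<open>B\<close> turns these into the sums of \<open>kirchhoff\<close>.\<close>
  have Lh: "L *\<^sub>v Matrix.vec m h = Matrix.vec m (\<lambda>j. if j = s then W else 0)" (is "_ = ?b")
  proof (rule eq_vecI)
    fix j assume "j < dim_vec ?b"
    then have j: "j < m" by simp
    have "Matrix.vec_index (L *\<^sub>v Matrix.vec m h) j = (\<Sum>i\<in>I. B i j * (top i - bot i))"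
      using j B_ap[of _ "\<lambda>t. t"] by (simp add: L_mult L_ap)
    also have "\<dots> = (if h j = H then W else 0)"
      unfolding B_def using j h_pos hY by (intro kirchhoff) (auto simp: Y_def)
    finally show "Matrix.vec_index (L *\<^sub>v Matrix.vec m h) j = Matrix.vec_index ?b j"
      using j s h_inj by auto
  qed (simp add: L_def)
  \<comment> \<open>The numerators of Cramer's rule for a unit current at \<open>s\<close>. The
    entry 1 in place of \<open>W\<close>, which may be irrational, keeps the matrices
    integral.\<close>
  define C where "C k = Determinant.det (replace_col L (Matrix.vec m (\<lambda>j. of_bool (j = s))) k)" for k
  have cramer: "h k * Determinant.det L = W * C k" if k: "k < m" for k
  proof -
    let ?e = "Matrix.vec m (\<lambda>j. of_bool (j = s)) :: real Matrix.vec"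
    have "L *\<^sub>v Matrix.vec m (\<lambda>j. h j / W) = ?e"
    proof (rule eq_vecI)
      fix j assume "j < dim_vec ?e"
      then have j: "j < m" by simp
      have "(\<Sum>k<m. L $$ (j, k) * (h k / W)) = (\<Sum>k<m. L $$ (j, k) * h k) / W"
        by (simp add: sum_divide_distrib)
      also have "\<dots> = of_bool (j = s)"
        using arg_cong[OF Lh, of "\<lambda>v. Matrix.vec_index v j"] L_mult[OF j, of h] j \<open>W > 0\<close> by auto
      finally show "Matrix.vec_index (L *\<^sub>v Matrix.vec m (\<lambda>j. h j / W)) j = Matrix.vec_index ?e j"
        using j by (simp add: L_mult)
    qed (simp add: L_def)
    then have "C k = h k / W * Determinant.det L"
      using cramer_lemma_mat[OF L, of "Matrix.vec m (\<lambda>j. h j / W)" k] k by (simp add: C_def)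
    then show ?thesis using \<open>W > 0\<close> by (simp add: field_simps)
  qed
  have L_Ints: "L $$ (j, k) \<in> \<int>" if "j < m" "k < m" for j k
    using that B_Ints by (auto simp: L_def intro!: Ints_sum Ints_mult)
  have C_Ints: "C k \<in> \<int>" for k
    unfolding C_def
    by (rule det_in_Ints[of _ m]) (use L L_Ints in \<open>auto simp: replace_col_def\<close>)
  have C_bound: "\<bar>C s\<bar> \<le> 4 ^ card I"
    unfolding C_def
  proof (rule det_bound)
    fix j k assume jk: "j < m" "k < m"
    \<comment> \<open>The replaced column vanishes except for a 1 at \<open>(s, s)\<close>, so the
      bound by the entries of \<open>L\<close> survives if \<open>L\<close> has at least 1 there. A
      square with upper side at \<open>H\<close> provides it.\<close>
    have "(1::real) \<le> L $$ (s, s)"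
    proof -
      obtain i where i: "i \<in> I" "top i = h s" using H s by auto
      have "1 = B i s * B i s" using i bt[OF i(1)] by (auto simp: B_def)
      also have "\<dots> \<le> (\<Sum>i\<in>I. B i s * B i s)" using i fin by (intro member_le_sum) auto
      finally show ?thesis using s by (simp add: L_def)
    qed
    then show "\<bar>replace_col L (Matrix.vec m (\<lambda>j. of_bool (j = s))) s $$ (j, k)\<bar> \<le> \<bar>L $$ (j, k)\<bar>"
      using jk s L by (auto simp: replace_col_def)
  qed (use L in \<open>simp add: replace_col_def\<close>)
  define c where "c = \<bar>Determinant.det L\<bar> / W"
  \<comment> \<open>The scale contains the absolute value of the determinant, so Cramer's rule
    yields the scaled heights up to this common sign.\<close>
  define \<sigma> where "\<sigma> = sgn (Determinant.det L)"
  have \<sigma>: "\<sigma> \<in> \<int>" "\<bar>\<sigma>\<bar> = 1" using det_L by (auto simp: \<sigma>_def sgn_real_def)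
  have ch: "c * h k = \<sigma> * C k" if "k < m" for k
  proof -
    have "c * h k = \<sigma> * (h k * Determinant.det L) / W"
      by (simp add: c_def \<sigma>_def abs_sgn mult.commute)
    then show ?thesis using cramer[OF that] \<open>W > 0\<close> by simp
  qed
  have c_Ints: "c * t \<in> \<int>" if tI: "t \<in> top ` I \<union> bot ` I" for t
  proof (cases "t = 0")
    case False
    then obtain k where "k < m" "h k = t" using h_surj[of t] tI by (auto simp: Y_def)
    then show ?thesis using ch[of k] \<sigma> C_Ints by auto
  qed simp
  show ?thesis
  proof (intro exI[of _ c] conjI ballI)
    show "0 < c" using det_L \<open>W > 0\<close> by (simp add: c_def)
    show "c * W \<le> 4 ^ card I" using det_bound[OF L] \<open>W > 0\<close> by (simp add: c_def)
    have "c * H = \<bar>c * H\<bar>" using \<open>0 < c\<close> \<open>H > 0\<close> by simp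
    also have "\<dots> = \<bar>C s\<bar>" using ch[OF s(1)] s(2) \<sigma>(2) by (simp add: abs_mult)
    finally show "c * H \<le> 4 ^ card I" using C_bound by simp
    fix i assume "i \<in> I"
    then show "c * (top i - bot i) \<in> \<int>"
      unfolding right_diff_distrib by (intro Ints_diff c_Ints) auto
  qed
qed

section \<open>Squares in coordinates\<close>

text \<open>
  The square with corner \<open>(x, y)\<close> and edge vectors \<open>(a, b)\<close> and \<open>(- b, a)\<close>. For \<open>a > 0\<close> and \<open>b \<ge> 0\<close> the
  corner \<open>(x, y)\<close> is a lowest point, and \<open>b > 0\<close> means that the square is tilted.
\<close>

definition sq :: "real \<Rightarrow> real \<Rightarrow> real \<Rightarrow> real \<Rightarrow> (real \<times> real) set" where
  "sq x y a b = {z. 0 \<le> a * (fst z - x) + b * (snd z - y) \<and> a * (fst z - x) + b * (snd z - y) \<le> a\<^sup>2 + b\<^sup>2 \<and>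
     0 \<le> a * (snd z - y) - b * (fst z - x) \<and> a * (snd z - y) - b * (fst z - x) \<le> a\<^sup>2 + b\<^sup>2}"

lemma closed_sq: "closed (sq x y a b)"
  unfolding sq_def by (intro closed_Collect_conj closed_Collect_le continuous_intros)

lemma sq_interiorI:
  assumes "0 < a * (fst z - x) + b * (snd z - y)" "a * (fst z - x) + b * (snd z - y) < a\<^sup>2 + b\<^sup>2"
    "0 < a * (snd z - y) - b * (fst z - x)" "a * (snd z - y) - b * (fst z - x) < a\<^sup>2 + b\<^sup>2"
  shows "z \<in> interior (sq x y a b)"
proof (rule interiorI)
  let ?U = "{z. 0 < a * (fst z - x) + b * (snd z - y) \<and> a * (fst z - x) + b * (snd z - y) < a\<^sup>2 + b\<^sup>2 \<and>
     0 < a * (snd z - y) - b * (fst z - x) \<and> a * (snd z - y) - b * (fst z - x) < a\<^sup>2 + b\<^sup>2}"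
  show "open ?U" by (intro open_Collect_conj open_Collect_less continuous_intros)
  show "z \<in> ?U" using assms by simp
  show "?U \<subseteq> sq x y a b" by (auto simp: sq_def)
qed

lemma sq_axis_parallel:
  assumes "a > 0"
  shows "sq x y a 0 = cbox (x, y) (x + a, y + a)"
  using assms
  by (auto simp: sq_def cbox_Pair_eq power2_eq_square zero_le_mult_iff mult_le_cancel_left)

text \<open>Adding \<open>b\<close> times the first and \<open>a\<close> times the second lower
  inequality of \<open>sq\<close> eliminates the horizontal coordinate. At height \<open>y\<close>,
  the same two inequalities bound it from both sides, because \<open>a\<close> and \<open>b\<close>
  are both positive.\<close>

lemma sq_lowest:
  assumes "z \<in> sq x y a b" "a > 0" "b > 0"
  shows "y \<le> snd z" and "snd z = y \<Longrightarrow> fst z = x"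
proof -
  define X Y where "X = fst z - x" and "Y = snd z - y"
  have 1: "0 \<le> a * X + b * Y" "0 \<le> a * Y - b * X"
    using assms(1) by (auto simp: sq_def X_def Y_def)
  have "0 \<le> b * (a * X + b * Y) + a * (a * Y - b * X)"
    by (rule add_nonneg_nonneg[OF mult_nonneg_nonneg mult_nonneg_nonneg]) (use 1 assms in auto)
  also have "\<dots> = (a\<^sup>2 + b\<^sup>2) * Y" by (simp add: algebra_simps power2_eq_square)
  finally have "0 \<le> (a\<^sup>2 + b\<^sup>2) * Y" .
  moreover have "0 < a\<^sup>2 + b\<^sup>2" using assms by (simp add: add_pos_pos)
  ultimately have "0 \<le> Y" by (simp add: zero_le_mult_iff)
  then show "y \<le> snd z" by (simp add: Y_def)
  assume "snd z = y"
  then have "0 \<le> a * X" "b * X \<le> 0" using 1 by (auto simp: Y_def)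
  then have "X = 0" using assms by (auto simp: zero_le_mult_iff mult_le_0_iff)
  then show "fst z = x" by (simp add: X_def)
qed

lemma sq_corners:
  shows "(x, y) \<in> sq x y a b" "(x + a, y + b) \<in> sq x y a b" "(x - b, y + a) \<in> sq x y a b"
  by (auto simp: sq_def power2_eq_square algebra_simps)

text \<open>The tiles that miss \<open>q\<close> have a closed union, so a whole ball around
  \<open>q\<close> avoids them. This lets a tile that comes close to \<open>q\<close> be recognised
  as one containing \<open>q\<close>.\<close>

lemma finite_closed_nearby:
  fixes q :: "'a::metric_space"
  assumes "finite T" "\<And>S. S \<in> T \<Longrightarrow> closed S"
  shows "\<exists>e>0. \<forall>z S. dist q z < e \<longrightarrow> S \<in> T \<longrightarrow> z \<in> S \<longrightarrow> q \<in> S"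
proof -
  have "open (- \<Union>{S\<in>T. q \<notin> S})"
    using assms by (intro open_Compl closed_Union) auto
  moreover have "q \<in> - \<Union>{S\<in>T. q \<notin> S}" by auto
  ultimately obtain e where "e > 0" "ball q e \<subseteq> - \<Union>{S\<in>T. q \<notin> S}"
    by (meson open_contains_ball)
  then show ?thesis by (intro exI[of _ e]) (auto simp: subset_iff)
qed

lemma sq_rotate: "sq x y a b = sq (x + a) (y + b) (- b) a"
  by (auto simp: sq_def power2_eq_square algebra_simps)

text \<open>Passing to the next corner turns the edge vector by a quarter turn. The four turns carry
  \<open>(a, b)\<close> through the four half-open quadrants, one of which is the desired
  one.\<close>

lemma sq_normalize:
  assumes "a \<noteq> 0 \<or> b \<noteq> 0"
  obtains x' y' a' b' where "sq x y a b = sq x' y' a' b'" "a' > 0" "b' \<ge> 0" "a'\<^sup>2 + b'\<^sup>2 = a\<^sup>2 + b\<^sup>2"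
proof -
  have rot: "sq x y a b = sq (x + a) (y + b) (- b) a"
    "sq x y a b = sq (x + a - b) (y + b + a) (- a) (- b)"
    "sq x y a b = sq (x - b) (y + a) b (- a)"
    using sq_rotate[of x y a b] sq_rotate[of "x + a" "y + b" "- b" a]
      sq_rotate[of "x + a - b" "y + b + a" "- a" "- b"] by simp_all
  consider "a > 0" "b \<ge> 0" | "- b > 0" "a \<ge> 0" | "- a > 0" "- b \<ge> 0" | "b > 0" "- a \<ge> 0"
    using assms by linarith
  then show ?thesis
  proof cases
    case 1 then show ?thesis by (intro that) auto
  next
    case 2 then show ?thesis by (intro that[OF rot(1)]) auto
  next
    case 3 then show ?thesis by (intro that[OF rot(2)]) auto
  next
    case 4 then show ?thesis by (intro that[OF rot(3)]) auto
  qed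
qed

text \<open>The two linear forms in \<open>sq\<close> are inner products with the edge vectors.
  These are orthogonal of squared length \<open>N\<close>, so the forms take the values
  \<open>s * N\<close> and \<open>t * N\<close>.\<close>

lemma sq_eq_parametrized:
  assumes "a \<noteq> 0 \<or> b \<noteq> 0"
  shows "{(x + s * a + t * (- b), y + s * b + t * a) | s t. s \<in> {0..1} \<and> t \<in> {0..1}} = sq x y a b"
proof -
  define N where "N = a\<^sup>2 + b\<^sup>2"
  have N: "N > 0" using assms unfolding N_def by (simp add: sum_power2_gt_zero_iff)
  show ?thesis
  proof (intro Set.set_eqI iffI)
    fix z assume "z \<in> {(x + s * a + t * (- b), y + s * b + t * a) | s t. s \<in> {0..1} \<and> t \<in> {0..1}}"
    then obtain s t where z: "z = (x + s * a + t * (- b), y + s * b + t * a)" and st: "s \<in> {0..1}" "t \<in> {0..1}"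
      by blast
    have "a * (fst z - x) + b * (snd z - y) = s * N" "a * (snd z - y) - b * (fst z - x) = t * N"
      by (simp_all add: z N_def power2_eq_square algebra_simps)
    moreover have "0 \<le> s * N" "s * N \<le> N" "0 \<le> t * N" "t * N \<le> N"
      using st N by (auto simp: mult_le_cancel_right1)
    ultimately show "z \<in> sq x y a b" by (simp add: sq_def flip: N_def)
  next
    fix z assume z: "z \<in> sq x y a b"
    define s where "s = (a * (fst z - x) + b * (snd z - y)) / N"
    define t where "t = (a * (snd z - y) - b * (fst z - x)) / N"
    have "s \<in> {0..1}" "t \<in> {0..1}"
      using z N by (simp_all add: s_def t_def sq_def flip: N_def)
    moreover have "N * (s * a - t * b) = N * (fst z - x)"
      using N by (simp add: s_def t_def field_simps) (simp add: N_def power2_eq_square algebra_simps)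
    moreover have "N * (s * b + t * a) = N * (snd z - y)"
      using N by (simp add: s_def t_def field_simps) (simp add: N_def power2_eq_square algebra_simps)
    ultimately have "z = (x + s * a + t * (- b), y + s * b + t * a)"
      using N by (intro prod_eqI) auto
    then show "z \<in> {(x + s * a + t * (- b), y + s * b + t * a) | s t. s \<in> {0..1} \<and> t \<in> {0..1}}"
      using \<open>s \<in> {0..1}\<close> \<open>t \<in> {0..1}\<close> by blast
  qed
qed

text \<open>Lagrange's identity shows that the determinant \<open>k\<close> of the two vectors is
  \<open>N\<close> or \<open>- N\<close>. Its sign decides between a counterclockwise and a
  clockwise quarter turn.\<close>

lemma orthogonal_same_norm_cases:
  fixes u1 u2 v1 v2 :: real
  assumes "u1\<^sup>2 + u2\<^sup>2 = N" "v1\<^sup>2 + v2\<^sup>2 = N" "u1 * v1 + u2 * v2 = 0" "N > 0"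
  shows "v1 = - u2 \<and> v2 = u1 \<or> v1 = u2 \<and> v2 = - u1"
proof -
  define k where "k = u1 * v2 - u2 * v1"
  have "k\<^sup>2 = (u1\<^sup>2 + u2\<^sup>2) * (v1\<^sup>2 + v2\<^sup>2) - (u1 * v1 + u2 * v2)\<^sup>2"
    by (simp add: k_def power2_eq_square algebra_simps)
  then have "k\<^sup>2 = N\<^sup>2" using assms by (simp add: power2_eq_square)
  then have k: "k = N \<or> k = - N" by (simp add: power2_eq_iff)
  have "N * v1 = - u2 * k + u1 * (u1 * v1 + u2 * v2)" "N * v2 = u1 * k + u2 * (u1 * v1 + u2 * v2)"
    by (simp_all add: k_def power2_eq_square algebra_simps flip: assms(1))
  then have Nv: "N * v1 = - u2 * k" "N * v2 = u1 * k" by (simp_all add: assms(3))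
  from k show ?thesis
  proof
    assume "k = N"
    then have "N * v1 = N * (- u2)" "N * v2 = N * u1" using Nv by simp_all
    then show ?thesis using \<open>N > 0\<close> unfolding mult_cancel_left by simp
  next
    assume "k = - N"
    then have "N * v1 = N * u2" "N * v2 = N * (- u1)" using Nv by simp_all
    then show ?thesis using \<open>N > 0\<close> unfolding mult_cancel_left by simp
  qed
qed

lemma orthonormal_expand2:
  fixes e f z :: "real^2"
  assumes "norm e = 1" "norm f = 1" "e \<bullet> f = 0"
  shows "z = (z \<bullet> e) *\<^sub>R e + (z \<bullet> f) *\<^sub>R f"
proof -
  have ef: "e \<noteq> f" using assms by (metis norm_eq_1 zero_neq_one)
  have po: "pairwise orthogonal {e, f}"
    using assms by (auto simp: pairwise_def orthogonal_def inner_commute)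
  have "0 \<notin> {e, f}" using assms by auto
  then have "independent {e, f}" using po pairwise_orthogonal_independent by blast
  then have "(UNIV :: (real^2) set) \<subseteq> span {e, f}"
    using ef by (intro card_ge_dim_independent) auto
  then have "z \<in> span {e, f}" by blast
  then have "(\<Sum>b\<in>{e, f}. (z \<bullet> b) *\<^sub>R b) = z"
    using orthonormal_basis_expand[of "{e, f}" z] po assms by auto
  then show ?thesis using ef by simp
qed

text \<open>Coordinates in an orthonormal frame preserve inner products, so the edges stay
  perpendicular and of length \<open>r\<close>, and each is a quarter turn of the other.\<close>

lemma frame_image_square:
  fixes e f p :: "real^2"
  assumes e: "norm e = 1" "norm f = 1" "e \<bullet> f = 0" and S: "square_with_side S r"
  obtains x y a b where "a > 0" "b \<ge> 0" "r = sqrt (a\<^sup>2 + b\<^sup>2)"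
    "(\<lambda>z. ((z - p) \<bullet> e, (z - p) \<bullet> f)) ` S = sq x y a b"
proof -
  obtain q u v where uv: "u \<noteq> 0" "v \<noteq> 0" "orthogonal u v" "norm u = r" "norm v = r"
    and S: "S = {q + s *\<^sub>R u + t *\<^sub>R v | s t. s \<in> {0..1} \<and> t \<in> {0..1}}"
    using S unfolding square_with_side_def rectangle_with_sides_def by blast
  have "r > 0" using uv by auto
  have parseval: "z \<bullet> w = (z \<bullet> e) * (w \<bullet> e) + (z \<bullet> f) * (w \<bullet> f)" for z w
    using arg_cong[OF orthonormal_expand2[OF e, of z], of "\<lambda>z. z \<bullet> w"]
    by (simp add: inner_add_left inner_commute[of e w] inner_commute[of f w])
  define x y where "x = (q - p) \<bullet> e" and "y = (q - p) \<bullet> f"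
  have img: "(\<lambda>z. ((z - p) \<bullet> e, (z - p) \<bullet> f)) ` S =
    {(x + s * (u \<bullet> e) + t * (v \<bullet> e), y + s * (u \<bullet> f) + t * (v \<bullet> f)) | s t. s \<in> {0..1} \<and> t \<in> {0..1}}"
    unfolding S by (force simp: image_iff x_def y_def inner_simps)
  have u: "(u \<bullet> e)\<^sup>2 + (u \<bullet> f)\<^sup>2 = r\<^sup>2"
    using parseval[of u u] uv by (simp add: power2_eq_square flip: power2_norm_eq_inner)
  have v: "(v \<bullet> e)\<^sup>2 + (v \<bullet> f)\<^sup>2 = r\<^sup>2"
    using parseval[of v v] uv by (simp add: power2_eq_square flip: power2_norm_eq_inner)
  have o: "(u \<bullet> e) * (v \<bullet> e) + (u \<bullet> f) * (v \<bullet> f) = 0"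
    using parseval[of u v] uv by (simp add: orthogonal_def)
  have "\<exists>a b. (\<lambda>z. ((z - p) \<bullet> e, (z - p) \<bullet> f)) ` S = sq x y a b \<and> a\<^sup>2 + b\<^sup>2 = r\<^sup>2"
    using orthogonal_same_norm_cases[OF u v o zero_less_power[OF \<open>r > 0\<close>]]
  proof
    assume *: "v \<bullet> e = - (u \<bullet> f) \<and> v \<bullet> f = u \<bullet> e"
    have "(\<lambda>z. ((z - p) \<bullet> e, (z - p) \<bullet> f)) ` S = sq x y (u \<bullet> e) (u \<bullet> f)"
      unfolding img using * u \<open>r > 0\<close> by (subst sq_eq_parametrized[symmetric]) auto
    then show ?thesis using u by blast
  next
    assume *: "v \<bullet> e = u \<bullet> f \<and> v \<bullet> f = - (u \<bullet> e)"
    \<comment> \<open>Here \<open>v\<close> is the clockwise turn of \<open>u\<close>, so exchanging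
      the edges restores the orientation used in \<open>sq\<close>.\<close>
    have "(\<lambda>z. ((z - p) \<bullet> e, (z - p) \<bullet> f)) ` S =
      {(x + s * (v \<bullet> e) + t * (u \<bullet> e), y + s * (v \<bullet> f) + t * (u \<bullet> f)) | s t. s \<in> {0..1} \<and> t \<in> {0..1}}"
      unfolding img by (auto simp: add_ac) (metis add.commute)+
    also have "\<dots> = sq x y (v \<bullet> e) (v \<bullet> f)"
      using * u \<open>r > 0\<close> by (subst sq_eq_parametrized[symmetric]) auto
    finally show ?thesis using v by blast
  qed
  then obtain a b where ab: "(\<lambda>z. ((z - p) \<bullet> e, (z - p) \<bullet> f)) ` S = sq x y a b" "a\<^sup>2 + b\<^sup>2 = r\<^sup>2" by blast
  then have "a \<noteq> 0 \<or> b \<noteq> 0" using \<open>r > 0\<close> by auto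
  then obtain x' y' a' b' where "sq x y a b = sq x' y' a' b'" "a' > 0" "b' \<ge> 0" "a'\<^sup>2 + b'\<^sup>2 = a\<^sup>2 + b\<^sup>2"
    by (rule sq_normalize)
  then show ?thesis using that[of a' b' x' y'] ab \<open>r > 0\<close> by simp
qed

lemma rectangle_with_sides_dilate:
  assumes "rectangle_with_sides R a b" "c > 0"
  shows "rectangle_with_sides (dilate c R) (c * a) (c * b)"
proof -
  obtain p u v where "u \<noteq> 0" "v \<noteq> 0" "orthogonal u v" "norm u = a" "norm v = b"
    and R: "R = {p + s *\<^sub>R u + t *\<^sub>R v | s t. s \<in> {0..1} \<and> t \<in> {0..1}}"
    using assms unfolding rectangle_with_sides_def by blast
  moreover have "dilate c R = {c *\<^sub>R p + s *\<^sub>R (c *\<^sub>R u) + t *\<^sub>R (c *\<^sub>R v) | s t. s \<in> {0..1} \<and> t \<in> {0..1}}"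
    unfolding R dilate_def by (force simp: image_iff scaleR_add_right mult.commute)
  ultimately show ?thesis
    unfolding rectangle_with_sides_def using \<open>c > 0\<close>
    by (intro exI[of _ "c *\<^sub>R p"] exI[of _ "c *\<^sub>R u"] exI[of _ "c *\<^sub>R v"]) (simp add: orthogonal_def)
qed

section \<open>Exclusion of tilted squares\<close>

lemma tiling_by_squares_axis_parallel:
  fixes x y a b :: "'i \<Rightarrow> real"
  assumes fin: "finite I"
    and a: "\<And>i. i \<in> I \<Longrightarrow> a i > 0" and b: "\<And>i. i \<in> I \<Longrightarrow> b i \<ge> 0"
    and R: "(\<Union>i\<in>I. sq (x i) (y i) (a i) (b i)) = cbox (0, 0) (W, H)"
    and disj: "\<And>i j. i \<in> I \<Longrightarrow> j \<in> I \<Longrightarrow> i \<noteq> j \<Longrightarrow>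
      interior (sq (x i) (y i) (a i) (b i)) \<inter> interior (sq (x j) (y j) (a j) (b j)) = {}"
  shows "\<forall>i\<in>I. b i = 0"
proof (rule ccontr)
  assume tilted: "\<not> (\<forall>i\<in>I. b i = 0)"
  define S where "S i = sq (x i) (y i) (a i) (b i)" for i
  define J where "J = {i\<in>I. b i > 0}"
  have "finite J" "J \<noteq> {}" using tilted fin b by (force simp: J_def)+
  then obtain k where k: "k \<in> J" "\<And>i. i \<in> J \<Longrightarrow> y k \<le> y i"
    using arg_min_if_finite[of J y] by (metis not_le)
  have kI: "k \<in> I" "a k > 0" "b k > 0" using k(1) a by (auto simp: J_def)
  define p where "p = (x k, y k)"
  have near: "\<exists>e>0. \<forall>z i. dist q z < e \<longrightarrow> i \<in> I \<longrightarrow> z \<in> S i \<longrightarrow> q \<in> S i" for q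
  proof -
    have "\<exists>e>0. \<forall>z A. dist q z < e \<longrightarrow> A \<in> S ` I \<longrightarrow> z \<in> A \<longrightarrow> q \<in> A"
      by (rule finite_closed_nearby) (use fin closed_sq in \<open>auto simp: S_def\<close>)
    then show ?thesis by (meson imageI)
  qed
  \<comment> \<open>Two opposite corners of this box are corners of the tilted square, so the box
    lies in the rectangle even where it leaves that square. Hence some tile covers each of its
    points.\<close>
  have in_R: "(x k + t, y k + s) \<in> cbox (0, 0) (W, H)" if "0 \<le> t" "t \<le> a k" "0 \<le> s" "s \<le> b k" for t s
  proof -
    have "(x k, y k) \<in> cbox (0, 0) (W, H)" "(x k + a k, y k + b k) \<in> cbox (0, 0) (W, H)"
      unfolding R[symmetric] by (rule UN_I[OF kI(1)], rule sq_corners)+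
    then show ?thesis using that by (auto simp: cbox_Pair_eq)
  qed
  obtain e where e: "e > 0" "\<And>z i. dist p z < e \<Longrightarrow> i \<in> I \<Longrightarrow> z \<in> S i \<Longrightarrow> p \<in> S i"
    using near[of p] by blast
  have "finite ((\<lambda>i. x i - x k) ` I)" using fin by simp
  then obtain e' where e': "e' > 0" "\<forall>w\<in>(\<lambda>i. x i - x k) ` I. w \<noteq> 0 \<longrightarrow> e' \<le> dist 0 w"
    using finite_set_avoid[of "(\<lambda>i. x i - x k) ` I" 0] by blast
  \<comment> \<open>Three demands: a tile containing \<open>q\<close> also contains
    \<open>p\<close>, \<open>q\<close> is not the lowest corner of a tilted square, and the points
    just above \<open>q\<close> lie in the rectangle.\<close>
  define t where "t = Min {e / 2, e' / 2, a k}"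
  have t: "0 < t" "t < e" "t < e'" "t \<le> a k" using e(1) e'(1) kI by (auto simp: t_def min_def)
  define q where "q = (x k + t, y k)"
  \<comment> \<open>By minimality of \<open>k\<close>, a tilted square meets the height
    \<open>y k\<close> at most in its lowest corner, and \<open>e'\<close> keeps \<open>q\<close>
    away from such corners.\<close>
  have q_tilted: "q \<notin> S i" if "i \<in> J" for i
  proof
    assume "q \<in> S i"
    then have "y i \<le> y k" "y k = y i \<longrightarrow> x k + t = x i"
      using sq_lowest[of q "x i" "y i" "a i" "b i"] that a by (auto simp: S_def J_def q_def)
    then have "x i - x k = t" using k(2)[OF that] by auto
    then show False using e'(2) that t by (auto simp: J_def dist_real_def)
  qed
  obtain d where d: "d > 0" "\<And>z i. dist q z < d \<Longrightarrow> i \<in> I \<Longrightarrow> z \<in> S i \<Longrightarrow> q \<in> S i"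
    using near[of q] by blast
  define s where "s = min (d / 2) (b k)"
  have s: "0 < s" "s < d" "s \<le> b k" using d(1) kI by (auto simp: s_def)
  \<comment> \<open>The tile covering the point just above \<open>q\<close> must contain
    \<open>q\<close>, and therefore \<open>p\<close>. Containing \<open>q\<close>, it is not
    tilted.\<close>
  obtain i where i: "i \<in> I" "(x k + t, y k + s) \<in> S i"
    using in_R[of t s] t s unfolding R[symmetric] by (auto simp: S_def)
  have qi: "q \<in> S i"
    by (rule d(2)[OF _ i]) (use s in \<open>simp add: q_def dist_Pair_Pair dist_real_def\<close>)
  have pi: "p \<in> S i"
    by (rule e(2)[OF _ i(1) qi]) (use t in \<open>simp add: p_def q_def dist_Pair_Pair dist_real_def\<close>)
  have "i \<notin> J" using q_tilted qi by blast
  then have bi: "b i = 0" "i \<noteq> k" using b[OF i(1)] i(1) k(1) by (auto simp: J_def)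
  have Si: "S i = cbox (x i, y i) (x i + a i, y i + a i)"
    using sq_axis_parallel a i(1) bi(1) by (simp add: S_def)
  \<comment> \<open>An axis-parallel tile containing \<open>p\<close> and the point offset from it
    by \<open>(t, s)\<close> contains the whole box between them.\<close>
  have box: "x i \<le> x k" "x k + t \<le> x i + a i" "y i \<le> y k" "y k + s \<le> y i + a i"
    using i(2) pi by (auto simp: Si p_def cbox_Pair_eq)
  \<comment> \<open>\<open>(a k / 2, m)\<close> is the combination \<open>(a, b) + t (- b, a)\<close> of the edges with \<open>t = a / (2 b)\<close>,
    so it points from \<open>p\<close> into the interior of the tilted square and into the positive quadrant.\<close>
  define m where "m = b k + (a k)\<^sup>2 / (2 * b k)"
  have m: "m > 0" using kI by (auto simp: m_def intro!: add_pos_nonneg)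
  \<comment> \<open>The first two bounds keep \<open>z\<close> inside that box. The other two keep
    its coordinates along the edges of the tilted square, \<open>r\<close> and
    \<open>r * a k / (2 * b k)\<close>, below 1.\<close>
  define r where "r = Min {t / a k, s / (2 * m), 1/2, b k / a k}"
  have "0 < r" using t s kI m by (auto simp: r_def)
  moreover have "r \<le> t / a k" "r \<le> s / (2 * m)" "r \<le> 1/2" "r \<le> b k / a k"
    unfolding r_def by (rule Min_le; simp)+
  ultimately have r: "0 < r" "r \<le> t / a k" "r \<le> s / (2 * m)" "r \<le> 1/2" "r \<le> b k / a k" .
  have r': "r * a k \<le> t" "r * m < s" "r < 1" "r * a k \<le> b k"
    using r s m kI by (auto simp: field_simps)
  define z where "z = (x k + r * a k / 2, y k + r * m)"
  have e1: "a k * (fst z - x k) + b k * (snd z - y k) = r * ((a k)\<^sup>2 + (b k)\<^sup>2)"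
    using kI by (simp add: z_def m_def field_simps power2_eq_square)
  have e2: "a k * (snd z - y k) - b k * (fst z - x k) = r * a k / (2 * b k) * ((a k)\<^sup>2 + (b k)\<^sup>2)"
    using kI by (simp add: z_def m_def field_simps power2_eq_square)
  have N: "0 < (a k)\<^sup>2 + (b k)\<^sup>2" using kI by (simp add: add_pos_pos)
  have "z \<in> interior (S k)"
    unfolding S_def
  proof (rule sq_interiorI; unfold e1 e2)
    have *: "r * a k / (2 * b k) < 1" using r'(4) kI by (simp add: field_simps)
    show "r * a k / (2 * b k) * ((a k)\<^sup>2 + (b k)\<^sup>2) < (a k)\<^sup>2 + (b k)\<^sup>2"
      using mult_strict_right_mono[OF * N] by simp
    show "r * ((a k)\<^sup>2 + (b k)\<^sup>2) < (a k)\<^sup>2 + (b k)\<^sup>2"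
      using mult_strict_right_mono[OF r'(3) N] by simp
  qed (use r kI N in auto)
  moreover have "z \<in> interior (S i)"
  proof -
    have "0 < r * a k" "0 < r * m" using r(1) m kI by auto
    then have "z \<in> box (x i, y i) (x i + a i, y i + a i)"
      using box r' t by (auto simp: z_def mem_box Basis_prod_def)
    then show ?thesis using interior_cbox Si by metis
  qed
  ultimately show False using disj[OF i(1) kI(1) bi(2)] by (auto simp: S_def)
qed

section \<open>Kirchhoff's current law from areas\<close>

lemma boxes_subset_bounds:
  fixes x y a :: "'i \<Rightarrow> real"
  assumes "(\<Union>i\<in>I. cbox (x i, y i) (x i + a i, y i + a i)) = cbox (0, 0) (W, H)"
    and "i \<in> I" "a i > 0"
  shows "0 \<le> x i" "x i + a i \<le> W" "0 \<le> y i" "y i + a i \<le> H"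
proof -
  have "(x i, y i) \<in> cbox (0, 0) (W, H)" "(x i + a i, y i + a i) \<in> cbox (0, 0) (W, H)"
    unfolding assms(1)[symmetric] using assms(2,3) by (auto intro!: bexI[of _ i] simp: cbox_Pair_eq)
  then show "0 \<le> x i" "x i + a i \<le> W" "0 \<le> y i" "y i + a i \<le> H" by (auto simp: cbox_Pair_eq)
qed

text \<open>Compare areas in the strip. Since no horizontal side lies strictly inside it, a tile
  either crosses it fully, with area \<open>a i * (\<beta> - \<alpha>)\<close>, or meets it in a
  null set. Overlaps are convex with empty interior, hence negligible.\<close>

lemma strip_width:
  fixes x y a :: "'i \<Rightarrow> real"
  assumes fin: "finite I"
    and a: "\<And>i. i \<in> I \<Longrightarrow> a i > 0"
    and R: "(\<Union>i\<in>I. cbox (x i, y i) (x i + a i, y i + a i)) = cbox (0, 0) (W, H)"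
    and disj: "\<And>i j. i \<in> I \<Longrightarrow> j \<in> I \<Longrightarrow> i \<noteq> j \<Longrightarrow>
      interior (cbox (x i, y i) (x i + a i, y i + a i)) \<inter> interior (cbox (x j, y j) (x j + a j, y j + a j)) = {}"
    and "W > 0" and \<alpha>\<beta>: "0 \<le> \<alpha>" "\<alpha> < \<beta>" "\<beta> \<le> H"
    and gap: "\<And>i. i \<in> I \<Longrightarrow> y i \<notin> {\<alpha><..<\<beta>}" "\<And>i. i \<in> I \<Longrightarrow> y i + a i \<notin> {\<alpha><..<\<beta>}"
  shows "(\<Sum>i | i \<in> I \<and> y i \<le> \<alpha> \<and> \<beta> \<le> y i + a i. a i) = W"
proof -
  define C where "C i = cbox (x i, max (y i) \<alpha>) (x i + a i, min (y i + a i) \<beta>)" for i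
  have C: "C i = cbox (x i, y i) (x i + a i, y i + a i) \<inter> cbox (0, \<alpha>) (W, \<beta>)" if "i \<in> I" for i
  proof -
    have "0 \<le> x i" "x i + a i \<le> W" using boxes_subset_bounds[OF R that a[OF that]] by auto
    then show ?thesis by (auto simp: C_def cbox_Pair_eq Times_Int_Times)
  qed
  have "(\<Union>i\<in>I. C i) = cbox (0, 0) (W, H) \<inter> cbox (0, \<alpha>) (W, \<beta>)"
    unfolding R[symmetric] using C by auto
  also have "\<dots> = cbox (0, \<alpha>) (W, \<beta>)" using \<alpha>\<beta> by (auto simp: cbox_Pair_eq)
  finally have "measure lebesgue (\<Union>(C ` I)) = W * (\<beta> - \<alpha>)"
    using \<open>W > 0\<close> \<alpha>\<beta> by (simp add: content_Pair)
  moreover have "measure lebesgue (\<Union>(C ` I)) = (\<Sum>i\<in>I. measure lebesgue (C i))"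
  proof (rule measure_negligible_finite_Union_image[OF fin])
    show "pairwise (\<lambda>i j. negligible (C i \<inter> C j)) I"
    proof (rule pairwiseI)
      fix i j assume "i \<in> I" "j \<in> I" "i \<noteq> j"
      have "interior (C i \<inter> C j) = {}"
        using disj[OF \<open>i \<in> I\<close> \<open>j \<in> I\<close> \<open>i \<noteq> j\<close>] C[OF \<open>i \<in> I\<close>] C[OF \<open>j \<in> I\<close>] by auto
      moreover have "convex (C i \<inter> C j)" by (simp add: C_def convex_Int)
      ultimately show "negligible (C i \<inter> C j)" by (simp add: negligible_convex_interior)
    qed
  qed (simp add: C_def)
  moreover have "measure lebesgue (C i) = (if y i \<le> \<alpha> \<and> \<beta> \<le> y i + a i then a i else 0) * (\<beta> - \<alpha>)"
    if "i \<in> I" for i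
  proof -
    have "y i \<le> \<alpha> \<or> \<beta> \<le> y i" "y i + a i \<le> \<alpha> \<or> \<beta> \<le> y i + a i"
      using gap[OF that] by force+
    then consider "y i \<le> \<alpha>" "\<beta> \<le> y i + a i" | "\<beta> \<le> y i" | "y i + a i \<le> \<alpha>" by blast
    then show ?thesis
      by cases (use a[OF that] \<alpha>\<beta> in \<open>simp_all add: C_def content_Pair\<close>)
  qed
  ultimately have "W * (\<beta> - \<alpha>) = (\<Sum>i\<in>I. if y i \<le> \<alpha> \<and> \<beta> \<le> y i + a i then a i else 0) * (\<beta> - \<alpha>)"
    by (simp add: sum_distrib_right)
  then show ?thesis
    using \<alpha>\<beta> fin by (simp add: sum.inter_filter)
qed


text \<open>Subtract the total width crossed just above \<open>t\<close> from that crossed just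
  below. Tiles passing through \<open>t\<close> cancel, leaving those that end there minus those
  that start there. Nothing lies above \<open>H\<close>, which is why \<open>W\<close>
  remains.\<close>

lemma kirchhoff:
  fixes x y a :: "'i \<Rightarrow> real"
  assumes fin: "finite I"
    and a: "\<And>i. i \<in> I \<Longrightarrow> a i > 0"
    and R: "(\<Union>i\<in>I. cbox (x i, y i) (x i + a i, y i + a i)) = cbox (0, 0) (W, H)"
    and disj: "\<And>i j. i \<in> I \<Longrightarrow> j \<in> I \<Longrightarrow> i \<noteq> j \<Longrightarrow>
      interior (cbox (x i, y i) (x i + a i, y i + a i)) \<inter> interior (cbox (x j, y j) (x j + a j, y j + a j)) = {}"
    and "W > 0" and t: "0 < t" "t \<le> H"
  shows "(\<Sum>i\<in>I. (of_bool (y i + a i = t) - of_bool (y i = t)) * a i) = (if t = H then W else 0)"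
proof -
  have yH: "0 \<le> y i" "y i + a i \<le> H" if "i \<in> I" for i
    using boxes_subset_bounds[OF R that a[OF that]] by auto
  define E where "E = y ` I \<union> (\<lambda>i. y i + a i) ` I \<union> {0, H}"
  have E: "finite E" "0 \<in> E" "H \<in> E" "\<And>i. i \<in> I \<Longrightarrow> y i \<in> E" "\<And>i. i \<in> I \<Longrightarrow> y i + a i \<in> E"
    using fin by (auto simp: E_def)
  note strip = strip_width[OF fin a R disj \<open>W > 0\<close>]
  have below: "(\<Sum>i | i \<in> I \<and> y i < t \<and> t \<le> y i + a i. a i) = W"
  proof -
    \<comment> \<open>The next lower side height; including 0 in \<open>E\<close> guarantees that
      one exists. No side lies between it and \<open>t\<close>, so \<open>strip_width\<close>
      applies.\<close>
    define \<alpha> where "\<alpha> = Max {e\<in>E. e < t}"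
    have ne: "finite {e\<in>E. e < t}" "{e\<in>E. e < t} \<noteq> {}" using E t by auto
    have \<alpha>: "\<alpha> < t" "\<And>e. e \<in> E \<Longrightarrow> e < t \<Longrightarrow> e \<le> \<alpha>"
      using Max_in[OF ne] Max_ge[OF ne(1)] by (auto simp: \<alpha>_def)
    have "(\<Sum>i | i \<in> I \<and> y i \<le> \<alpha> \<and> t \<le> y i + a i. a i) = W"
    proof (rule strip)
      show "0 \<le> \<alpha>" using \<alpha>(2)[OF E(2)] t by simp
      fix i assume i: "i \<in> I"
      show "y i \<notin> {\<alpha><..<t}" "y i + a i \<notin> {\<alpha><..<t}"
        using \<alpha>(2)[OF E(4)[OF i]] \<alpha>(2)[OF E(5)[OF i]] by auto
    qed (use \<alpha> t in auto)
    moreover have "{i. i \<in> I \<and> y i \<le> \<alpha> \<and> t \<le> y i + a i} = {i. i \<in> I \<and> y i < t \<and> t \<le> y i + a i}"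
      using \<alpha>(1) \<alpha>(2)[OF E(4)] by force
    ultimately show ?thesis by simp
  qed
  have above: "(\<Sum>i | i \<in> I \<and> y i \<le> t \<and> t < y i + a i. a i) = (if t = H then 0 else W)"
  proof (cases "t = H")
    case True
    then have "{i. i \<in> I \<and> y i \<le> t \<and> t < y i + a i} = {}" using yH by force
    then have "(\<Sum>i | i \<in> I \<and> y i \<le> t \<and> t < y i + a i. a i) = 0" by (simp only: sum.empty)
    then show ?thesis unfolding if_P[OF True] .
  next
    case False
    define \<beta> where "\<beta> = Min {e\<in>E. t < e}"
    have ne: "finite {e\<in>E. t < e}" "{e\<in>E. t < e} \<noteq> {}" using E t False by auto
    have \<beta>: "t < \<beta>" "\<And>e. e \<in> E \<Longrightarrow> t < e \<Longrightarrow> \<beta> \<le> e"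
      using Min_in[OF ne] Min_le[OF ne(1)] by (auto simp: \<beta>_def)
    have "(\<Sum>i | i \<in> I \<and> y i \<le> t \<and> \<beta> \<le> y i + a i. a i) = W"
    proof (rule strip)
      show "\<beta> \<le> H" using \<beta>(2)[OF E(3)] t False by simp
      fix i assume i: "i \<in> I"
      show "y i \<notin> {t<..<\<beta>}" "y i + a i \<notin> {t<..<\<beta>}"
        using \<beta>(2)[OF E(4)[OF i]] \<beta>(2)[OF E(5)[OF i]] by auto
    qed (use \<beta> t in auto)
    moreover have "{i. i \<in> I \<and> y i \<le> t \<and> \<beta> \<le> y i + a i} = {i. i \<in> I \<and> y i \<le> t \<and> t < y i + a i}"
      using \<beta>(1) \<beta>(2)[OF E(5)] by force
    ultimately show ?thesis using False by simp
  qed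
  have "(\<Sum>i\<in>I. (of_bool (y i + a i = t) - of_bool (y i = t)) * a i) =
    (\<Sum>i\<in>I. (if y i < t \<and> t \<le> y i + a i then a i else 0) - (if y i \<le> t \<and> t < y i + a i then a i else 0))"
  proof (rule sum.cong[OF refl])
    fix i assume "i \<in> I"
    then show "(of_bool (y i + a i = t) - of_bool (y i = t)) * a i =
      (if y i < t \<and> t \<le> y i + a i then a i else 0) - (if y i \<le> t \<and> t < y i + a i then a i else 0)"
      using a[of i] by auto
  qed
  also have "\<dots> = (\<Sum>i | i \<in> I \<and> y i < t \<and> t \<le> y i + a i. a i) - (\<Sum>i | i \<in> I \<and> y i \<le> t \<and> t < y i + a i. a i)"
    using fin by (simp add: sum_subtractf sum.inter_filter)
  finally show ?thesis using below above by simp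
qed

lemma parallel_square_tiling_scaling:
  fixes x y a :: "'i \<Rightarrow> real"
  assumes fin: "finite I"
    and a: "\<And>i. i \<in> I \<Longrightarrow> a i > 0"
    and R: "(\<Union>i\<in>I. cbox (x i, y i) (x i + a i, y i + a i)) = cbox (0, 0) (W, H)"
    and disj: "\<And>i j. i \<in> I \<Longrightarrow> j \<in> I \<Longrightarrow> i \<noteq> j \<Longrightarrow>
      interior (cbox (x i, y i) (x i + a i, y i + a i)) \<inter> interior (cbox (x j, y j) (x j + a j, y j + a j)) = {}"
    and "W > 0" "H > 0"
  shows "\<exists>c>0. c * W \<le> 4 ^ card I \<and> c * H \<le> 4 ^ card I \<and> (\<forall>i\<in>I. c * a i \<in> \<int>)"
proof -
  note bounds = boxes_subset_bounds[OF R _ a]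
  have K: "(\<Sum>i\<in>I. (of_bool (y i + a i = t) - of_bool (y i = t)) * a i) = (if t = H then W else 0)"
    if "0 < t" "t \<le> H" for t
    using kirchhoff[OF fin a R disj \<open>W > 0\<close> that] .
  \<comment> \<open>Without a tile ending at \<open>H\<close>, every term of the current law at
    \<open>H\<close> would vanish, although the sum is \<open>W\<close>.\<close>
  have H: "H \<in> (\<lambda>i. y i + a i) ` I"
  proof (rule ccontr)
    assume no: "H \<notin> (\<lambda>i. y i + a i) ` I"
    have "(\<Sum>i\<in>I. (of_bool (y i + a i = H) - of_bool (y i = H)) * a i) = 0"
    proof (rule sum.neutral, rule ballI)
      fix i assume "i \<in> I"
      then have "y i + a i \<noteq> H" "y i \<noteq> H" using no a[of i] bounds(4)[of i] by auto
      then show "(of_bool (y i + a i = H) - of_bool (y i = H)) * a i = 0" by simp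
    qed
    then show False using K[of H] \<open>W > 0\<close> \<open>H > 0\<close> by simp
  qed
  have "\<exists>c>0. c * W \<le> 4 ^ card I \<and> c * H \<le> 4 ^ card I \<and> (\<forall>i\<in>I. c * ((y i + a i) - y i) \<in> \<int>)"
  proof (rule network_integral_scaling[OF fin _ _ \<open>W > 0\<close> \<open>H > 0\<close> H])
    fix t assume t: "0 < t" "t \<in> (\<lambda>i. y i + a i) ` I \<union> y ` I"
    then obtain i where "i \<in> I" "t \<le> y i + a i" using a by (auto simp: less_imp_le)
    then have "t \<le> H" using bounds(4)[of i] by simp
    then show "(\<Sum>i\<in>I. (of_bool (y i + a i = t) - of_bool (y i = t)) * (y i + a i - y i)) = (if t = H then W else 0)"
      using K[OF t(1)] by simp
  qed (use a bounds(3) in auto)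
  then show ?thesis by simp
qed

section \<open>Transfer to an arbitrary rectangle in the plane\<close>

theorem theorem4p2:
  fixes R :: "(real^2) set" and T :: "(real^2) set set" and n :: nat
  assumes "is_rectangle R"
    and "is_tiling T R"
    and "\<forall>S\<in>T. is_square S"
    and "card T = n"
  shows "\<exists>c::real. c > 0 \<and>
           (\<exists>a b. rectangle_with_sides (dilate c R) a b \<and> max a b \<le> 4 ^ n) \<and>
           (\<forall>S \<in> dilate c ` T. \<exists>a\<in>\<int>. square_with_side S a)"
proof -
  have fin: "finite T" and UT: "\<Union>T = R"
    and disj: "\<And>A B. A \<in> T \<Longrightarrow> B \<in> T \<Longrightarrow> A \<noteq> B \<Longrightarrow> interior A \<inter> interior B = {}"
    using assms(2) by (auto simp: is_tiling_def pairwise_def)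
  obtain W H where "rectangle_with_sides R W H" using assms(1) is_rectangle_def by blast
  then obtain p u v where uv: "u \<noteq> 0" "v \<noteq> 0" "orthogonal u v" "norm u = W" "norm v = H"
    and R: "R = {p + s *\<^sub>R u + t *\<^sub>R v | s t. s \<in> {0..1} \<and> t \<in> {0..1}}"
    unfolding rectangle_with_sides_def by blast
  have WH: "W > 0" "H > 0" using uv by auto
  define e f where "e = u /\<^sub>R W" and "f = v /\<^sub>R H"
  have ef: "norm e = 1" "norm f = 1" "e \<bullet> f = 0"
    using uv WH by (simp_all add: e_def f_def orthogonal_def)
  have u: "u = W *\<^sub>R e" and v: "v = H *\<^sub>R f" using WH by (simp_all add: e_def f_def)
  have ee: "e \<bullet> e = 1" "f \<bullet> f = 1" "f \<bullet> e = 0" using ef by (simp_all add: norm_eq_1 inner_commute)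
  define \<Phi> where "\<Phi> z = ((z - p) \<bullet> e, (z - p) \<bullet> f)" for z
  define \<Psi> where "\<Psi> w = p + fst w *\<^sub>R e + snd w *\<^sub>R f" for w :: "real \<times> real"
  have \<Phi>\<Psi>: "\<Phi> (\<Psi> w) = w" for w
    by (simp add: \<Phi>_def \<Psi>_def inner_simps ee ef)
  have \<Psi>\<Phi>: "\<Psi> (\<Phi> z) = z" for z
    using orthonormal_expand2[OF ef, of "z - p"] by (simp add: \<Phi>_def \<Psi>_def algebra_simps)
  have cont: "continuous_on UNIV \<Phi>" unfolding \<Phi>_def by (intro continuous_intros)
  \<comment> \<open>An open set inside two image tiles pulls back under the continuous injective map
    to an open set inside both original tiles.\<close>
  have disj': "interior (\<Phi> ` A) \<inter> interior (\<Phi> ` B) = {}" if "A \<in> T" "B \<in> T" "A \<noteq> B" for A B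
  proof -
    let ?U = "interior (\<Phi> ` A) \<inter> interior (\<Phi> ` B)"
    have inj: "inj \<Phi>" using \<Psi>\<Phi> by (metis injI)
    have "open (\<Phi> -` ?U)" using cont by (intro open_vimage) auto
    moreover have sub: "\<Phi> -` interior (\<Phi> ` C) \<subseteq> C" for C
      using vimage_mono[OF interior_subset[of "\<Phi> ` C"], of \<Phi>] inj by (simp add: inj_vimage_image_eq)
    ultimately have "\<Phi> -` ?U \<subseteq> interior A \<inter> interior B"
      using sub[of A] sub[of B] by (intro Int_greatest interior_maximal) auto
    then have "\<Phi> -` ?U = {}" using disj[OF that] by blast
    then show ?thesis using \<Phi>\<Psi> by (metis ex_in_conv vimage_eq)
  qed
  have \<Phi>R: "\<Phi> ` R = cbox (0, 0) (W, H)"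
  proof (intro Set.set_eqI iffI)
    fix w assume "w \<in> \<Phi> ` R"
    then obtain s t where "s \<in> {0..1}" "t \<in> {0..1}" "w = \<Phi> (\<Psi> (s * W, t * H))"
      unfolding R by (auto simp: \<Psi>_def u v)
    then show "w \<in> cbox (0, 0) (W, H)" using WH by (auto simp: \<Phi>\<Psi> cbox_Pair_eq mult_left_le_one_le)
  next
    fix w assume w: "w \<in> cbox (0, 0) (W, H)"
    have "\<Psi> w = p + (fst w / W) *\<^sub>R u + (snd w / H) *\<^sub>R v" using WH by (simp add: \<Psi>_def u v)
    moreover have "fst w / W \<in> {0..1}" "snd w / H \<in> {0..1}" using w WH by (auto simp: cbox_Pair_eq)
    ultimately have "\<Psi> w \<in> R" unfolding R by blast
    then show "w \<in> \<Phi> ` R" using \<Phi>\<Psi> by (metis imageI)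
  qed
  \<comment> \<open>The side length of the original tile is recorded with its coordinates, so that
    \<open>b S = 0\<close> later identifies this length as \<open>a S\<close>.\<close>
  define P where "P S x y a b \<longleftrightarrow> a > 0 \<and> b \<ge> 0 \<and>
    square_with_side S (sqrt (a\<^sup>2 + b\<^sup>2)) \<and> \<Phi> ` S = sq x y a b" for S x y a b
  have "\<forall>S\<in>T. \<exists>x y a b. P S x y a b"
  proof
    fix S assume "S \<in> T"
    then obtain r where r: "square_with_side S r" using assms(3) is_square_def by blast
    obtain x y a b where "a > 0" "b \<ge> 0" "r = sqrt (a\<^sup>2 + b\<^sup>2)" "\<Phi> ` S = sq x y a b"
      by (rule frame_image_square[OF ef r, of p, folded \<Phi>_def])
    then have "P S x y a b" using r by (simp add: P_def)
    then show "\<exists>x y a b. P S x y a b" by blast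
  qed
  from bchoice[OF this] obtain x where "\<forall>S\<in>T. \<exists>y a b. P S (x S) y a b" ..
  from bchoice[OF this] obtain y where "\<forall>S\<in>T. \<exists>a b. P S (x S) (y S) a b" ..
  from bchoice[OF this] obtain a where "\<forall>S\<in>T. \<exists>b. P S (x S) (y S) (a S) b" ..
  from bchoice[OF this] obtain b where P: "\<forall>S\<in>T. P S (x S) (y S) (a S) (b S)" ..
  have sq: "a S > 0" "b S \<ge> 0" "square_with_side S (sqrt ((a S)\<^sup>2 + (b S)\<^sup>2))"
    "\<Phi> ` S = sq (x S) (y S) (a S) (b S)" if "S \<in> T" for S
    using bspec[OF P that] by (simp_all add: P_def)
  have "(\<Union>S\<in>T. sq (x S) (y S) (a S) (b S)) = (\<Union>S\<in>T. \<Phi> ` S)" using sq(4) by simp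
  also have "\<dots> = cbox (0, 0) (W, H)" unfolding \<Phi>R[symmetric] UT[symmetric] by blast
  finally have Un: "(\<Union>S\<in>T. sq (x S) (y S) (a S) (b S)) = cbox (0, 0) (W, H)" .
  have "\<forall>S\<in>T. b S = 0"
    by (rule tiling_by_squares_axis_parallel[OF fin sq(1,2) Un]) (use disj' sq(4) in auto)
  then have b0: "b S = 0" if "S \<in> T" for S using that by blast
  have box: "\<Phi> ` S = cbox (x S, y S) (x S + a S, y S + a S)" if "S \<in> T" for S
    using sq(4)[OF that] sq_axis_parallel[OF sq(1)[OF that]] b0[OF that] by simp
  have "\<exists>c>0. c * W \<le> 4 ^ card T \<and> c * H \<le> 4 ^ card T \<and> (\<forall>S\<in>T. c * a S \<in> \<int>)"
  proof (rule parallel_square_tiling_scaling[OF fin sq(1) _ _ WH])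
    show "(\<Union>S\<in>T. cbox (x S, y S) (x S + a S, y S + a S)) = cbox (0, 0) (W, H)"
      unfolding Un[symmetric] using box sq(4) by auto
  qed (use disj' box in auto)
  then obtain c where c: "c > 0" "c * W \<le> 4 ^ n" "c * H \<le> 4 ^ n" "\<And>S. S \<in> T \<Longrightarrow> c * a S \<in> \<int>"
    using assms(4) by blast
  have "\<exists>a\<in>\<int>. square_with_side (dilate c S) a" if "S \<in> T" for S
  proof
    have "square_with_side S (a S)" using sq(1,3)[OF that] b0[OF that] by simp
    then show "square_with_side (dilate c S) (c * a S)"
      using c(1) unfolding square_with_side_def by (rule rectangle_with_sides_dilate)
  qed (use c(4) that in simp)
  then show ?thesis
    using c rectangle_with_sides_dilate[OF \<open>rectangle_with_sides R W H\<close> c(1)]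
    by (intro exI[of _ c] conjI exI[of _ "c * W"] exI[of _ "c * H"]) auto
qed

end
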